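(* Let $(\Lambda_t)_{t\ge 0}$ be a Hazard process and let $\tau_1\le\dots\le\tau_m$ be the successive jump times of the associated doubly-stochastic Poisson process, as defined in the context. For $0\le t<T$, denote the (conditional) cumulant generating function of $\Lambda_T$ by $$\Psi(u):=\log\mathbb{E}\left[\left.\exp\{\mathrm{i}u\Lambda_T\}\right|\mathcal{F}_t\right].$$ Let $1\le n\le m$. If $\Lambda_T$ has a finite conditional $n$-th moment, i.e. $\mathbb{E}[\Lambda_T^n\mid\mathcal{F}_t]<\infty$, then $$\mathbb{P}(\tau_n>T\mid\mathcal{F}_t)=\mathbf{1}_{\{\tau_n>t\}}\sum_{k=0}^{n-1}\frac{\mathrm{e}^{\Psi(\mathrm{i})}}{k!\,\mathrm{i}^k}\,\mathbf{B}_k\left(\frac{\partial\Psi}{\partial u}(\mathrm{i}),\dots,\frac{\partial^k\Psi}{\partial u^k}(\mathrm{i})\right),$$ where $\mathbf{B}_k$ is the $k$-th Bell polynomial.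
   Context: Setting: $(\Omega,\mathcal{F},\mathbb{P})$ is a probability space with a filtration $\mathbb{F}=(\mathcal{F}_t)_{t\ge0}$ satisfying the usual conditions ($\mathbb{P}$-completeness and right-continuity), and $\mathcal{F}_\infty=\sigma(\bigcup_{t\ge 0}\mathcal{F}_t)$. A Hazard process is a non-decreasing càdlàg $\mathbb{F}$-adapted real process $(\Lambda_t)_{t\ge0}$ with $\Lambda_0=0$. Let $\eta_1,\dots,\eta_m$ be i.i.d. exponential random variables with parameter $1$, independent of $\mathcal{F}_\infty$. The $n$-th jump of the doubly-stochastic Poisson process with Hazard process $\Lambda$ is $$\tau_n=\inf\{t>0:\ \Lambda_t\ge\eta_1+\dots+\eta_n\},\qquad n=1,\dots,m.$$ The indicator $\mathbf{1}_{\{\tau_n>t\}}$ is that of the event $\{\tau_n>t\}$. Meaning of $\Psi$ at $u=\mathrm{i}$: since $\Lambda_T\ge0$, the function $\varphi(u)=\mathbb{E}[\mathrm{e}^{\mathrm{i}u\Lambda_T}\mid\mathcal{F}_t]$ is defined for complex $u$ with $\operatorname{Im}u\ge0$, and $\varphi(\mathrm{i})=\mathbb{E}[\mathrm{e}^{-\Lambda_T}\mid\mathcal{F}_t]>0$; $\Psi=\log\varphi$ near $u=\mathrm{i}$, with derivatives taken with respect to $u$. Bell polynomials: $\mathbf{B}_n(x_1,\dots,x_n)=\sum_{k=0}^n\mathbf{B}_{n,k}(x_1,\dots,x_{n-k+1})$, where $\mathbf{B}_{0,0}:=1$ (so $\mathbf{B}_0=1$) and $$\mathbf{B}_{n,k}(x_1,\dots,x_{n-k+1})=\sum\frac{n!}{j_1!\,j_2!\cdots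 j_{n-k+1}!}\left(\frac{x_1}{1!}\right)^{j_1}\left(\frac{x_2}{2!}\right)^{j_2}\cdots\left(\frac{x_{n-k+1}}{(n-k+1)!}\right)^{j_{n-k+1}},$$ the sum running over all sequences of non-negative integers with $j_1+j_2+\cdots=k$ and $j_1+2j_2+3j_3+\cdots=n$. For example $\mathbf{B}_1=x_1$, $\mathbf{B}_2=x_1^2+x_2$, $\mathbf{B}_3=x_1^3+3x_1x_2+x_3$.
   Formalization: The identity with the indicator of {τ_n>t} is false on {τ_n≤t} (e.g. Λ_t=t, trivial filtration); proved instead: P(τ_n>T|F_t) equals the sum without the indicator a.s., hence the display a.s. on {τ_n>t}, for any version of E[exp(iuΛ_T)|F_t] holomorphic in u on Im u>0. *)

theory Defs
  imports "HOL-Probability.Probability"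
begin

text \<open>Time is the half-line: a filtration is a family indexed by \<^typ>\<open>real\<close> of which only the
  members with index \<open>t \<ge> 0\<close> are ever used.\<close>

definition filtration_usual :: "'a measure \<Rightarrow> (real \<Rightarrow> 'a measure) \<Rightarrow> bool" where
  "filtration_usual M F \<longleftrightarrow>
     (\<forall>t\<ge>0. subalgebra M (F t)) \<and>
     (\<forall>s t. 0 \<le> s \<and> s \<le> t \<longrightarrow> sets (F s) \<subseteq> sets (F t)) \<and>
     (\<forall>N\<in>null_sets M. \<forall>A\<subseteq>N. A \<in> sets (F 0)) \<and>
     (\<forall>t\<ge>0. sets (F t) = (\<Inter>s\<in>{t<..}. sets (F s)))"

definition sigma_infinity :: "'a measure \<Rightarrow> (real \<Rightarrow> 'a measure) \<Rightarrow> 'a measure" where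
  "sigma_infinity M F = sigma (space M) (\<Union>t\<in>{0..}. sets (F t))"

definition hazard_process ::
  "'a measure \<Rightarrow> (real \<Rightarrow> 'a measure) \<Rightarrow> (real \<Rightarrow> 'a \<Rightarrow> real) \<Rightarrow> bool" where
  "hazard_process M F \<Lambda> \<longleftrightarrow>
     (\<forall>t\<ge>0. \<Lambda> t \<in> borel_measurable (F t)) \<and>
     (\<forall>\<omega>\<in>space M.
        \<Lambda> 0 \<omega> = 0 \<and>
        mono_on {0..} (\<lambda>t. \<Lambda> t \<omega>) \<and>
        (\<forall>t\<ge>0. continuous (at_right t) (\<lambda>s. \<Lambda> s \<omega>)) \<and>
        (\<forall>t>0. \<exists>l. ((\<lambda>s. \<Lambda> s \<omega>) \<longlongrightarrow> l) (at_left t)))"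

text \<open>The second conjunct is joint: the whole vector \<open>(\<eta> 1, \<dots>, \<eta> m)\<close> is independent of
  \<open>F\<^sub>\<infinity>\<close>.\<close>

definition exponential_thresholds ::
  "'a measure \<Rightarrow> (real \<Rightarrow> 'a measure) \<Rightarrow> nat \<Rightarrow> (nat \<Rightarrow> 'a \<Rightarrow> real) \<Rightarrow> bool" where
  "exponential_thresholds M F m \<eta> \<longleftrightarrow>
     (\<forall>i\<in>{1..m}. distributed M lborel (\<eta> i) (exponential_density 1)) \<and>
     prob_space.indep_vars M (\<lambda>_. borel) \<eta> {1..m} \<and>
     prob_space.indep_set M (sets (sigma_infinity M F))
       (sets (vimage_algebra (space M) (\<lambda>\<omega>. \<lambda>i\<in>{1..m}. \<eta> i \<omega>) (\<Pi>\<^sub>M i\<in>{1..m}. borel)))"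

text \<open>Extended real valued, so that \<open>inf {} = \<infinity>\<close>.\<close>

definition jump_time :: "(real \<Rightarrow> 'a \<Rightarrow> real) \<Rightarrow> (nat \<Rightarrow> 'a \<Rightarrow> real) \<Rightarrow> nat \<Rightarrow> 'a \<Rightarrow> ereal" where
  "jump_time \<Lambda> \<eta> n \<omega> = Inf (ereal ` {t. 0 < t \<and> (\<Sum>i=1..n. \<eta> i \<omega>) \<le> \<Lambda> t \<omega>})"

definition cond_prob_given :: "'a measure \<Rightarrow> 'a measure \<Rightarrow> 'a set \<Rightarrow> 'a \<Rightarrow> real" where
  "cond_prob_given M G A = real_cond_exp M G (indicat_real A)"

definition complex_cond_exp :: "'a measure \<Rightarrow> 'a measure \<Rightarrow> ('a \<Rightarrow> complex) \<Rightarrow> 'a \<Rightarrow> complex" where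
  "complex_cond_exp M G f = (\<lambda>\<omega>.
     Complex (real_cond_exp M G (\<lambda>x. Re (f x)) \<omega>) (real_cond_exp M G (\<lambda>x. Im (f x)) \<omega>))"

text \<open>A conditional expectation is only defined up to a null set that may depend on \<open>u\<close>, so for
  fixed \<open>\<omega>\<close> the map \<open>u \<mapsto> E[exp (\<i> u X) | G](\<omega>)\<close> can be differentiated only after versions have
  been chosen compatibly.  The predicate below says that \<open>\<phi>\<close> is such a choice: for each \<open>u\<close> in the
  closed upper half-plane it is a version of the conditional expectation, and almost all of its
  paths are holomorphic on the open upper half-plane.  For \<open>X \<ge> 0\<close> a regular conditional
  distribution of \<open>X\<close> given \<open>G\<close> yields one, and any two agree on the open half-plane
  outside a single null set.\<close>

definition cond_char_function ::
  "'a measure \<Rightarrow> 'a measure \<Rightarrow> ('a \<Rightarrow> real) \<Rightarrow> ('a \<Rightarrow> complex \<Rightarrow> complex) \<Rightarrow> bool" where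
  "cond_char_function M G X \<phi> \<longleftrightarrow>
     (\<forall>u. 0 \<le> Im u \<longrightarrow>
        (AE \<omega> in M. \<phi> \<omega> u = complex_cond_exp M G (\<lambda>x. exp (\<i> * u * of_real (X x))) \<omega>)) \<and>
     (AE \<omega> in M. \<phi> \<omega> holomorphic_on {u. 0 < Im u})"

text \<open>The bound \<open>j i \<le> k\<close> contained in the index set follows from \<open>\<Sum>i. j i = k\<close>; it makes the
  finiteness of the set evident.  Only \<open>k \<le> n\<close> is meaningful.\<close>

definition partial_bell :: "nat \<Rightarrow> nat \<Rightarrow> (nat \<Rightarrow> 'a::field_char_0) \<Rightarrow> 'a" where
  "partial_bell n k x =
     (\<Sum>j\<in>{j \<in> {1..n-k+1} \<rightarrow>\<^sub>E {0..k}.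
           (\<Sum>i=1..n-k+1. j i) = k \<and> (\<Sum>i=1..n-k+1. i * j i) = n}.
        fact n / (\<Prod>i=1..n-k+1. fact (j i)) * (\<Prod>i=1..n-k+1. (x i / fact i) ^ j i))"

definition bell_poly :: "nat \<Rightarrow> (nat \<Rightarrow> 'a::field_char_0) \<Rightarrow> 'a" where
  "bell_poly n x = (\<Sum>k=0..n. partial_bell n k x)"

end

theory Submission
  imports Defs "HOL-Complex_Analysis.Complex_Analysis"
begin

text \<open>By monotonicity and right-continuity, \<open>\<tau>\<^sub>n > T\<close> means \<open>\<Lambda>\<^sub>T < \<eta>\<^sub>1 + \<dots> + \<eta>\<^sub>n\<close>. The sum is Erlang
  distributed and independent of \<open>F\<^sub>\<infinity>\<close>, so Fubini and the Erlang tail give the conditional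
  probability \<open>\<Sum>k<n. c\<^sub>k\<close> with \<open>c\<^sub>k = E[\<Lambda>\<^sub>T\<^sup>k exp (- \<Lambda>\<^sub>T) / k! | F\<^sub>t]\<close>.
  Since \<open>0 \<le> c\<^sub>k \<le> 1\<close>, the series \<open>\<Sum>k. c\<^sub>k (1 + \<i> u)\<^sup>k\<close> converges on the unit disc around \<open>\<i>\<close>. It agrees
  with \<open>\<phi>\<close> at the countably many points \<open>\<i> y\<close> with \<open>y\<close> rational in \<open>(0, 1)\<close>, which accumulate at \<open>\<i>\<close>;
  by the identity theorem \<open>c\<^sub>k\<close> is the \<open>k\<close>-th derivative of \<open>\<phi>\<close> at \<open>\<i>\<close> divided by \<open>k! \<i>\<^sup>k\<close>. Writing
  \<open>\<phi> = exp \<Psi>\<close> near \<open>\<i>\<close> turns that derivative into \<open>exp \<Psi>\<close> times a Bell polynomial, because both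
  satisfy the same recurrence.\<close>

section \<open>Bell polynomials as sums over integer partitions, and their recurrence\<close>

text \<open>\<open>p i\<close> is the number of parts of size \<open>i\<close>. Keeping \<open>N\<close> independent of \<open>n\<close> avoids changing the
  index range in the recurrence.\<close>

definition part_mults :: "nat \<Rightarrow> nat \<Rightarrow> (nat \<Rightarrow> nat) set" where
  "part_mults N n = {p. (\<forall>i. i \<notin> {1..N} \<longrightarrow> p i = 0) \<and> (\<Sum>i=1..N. i * p i) = n}"

text \<open>Summed over \<open>part_mults N n\<close>, this gives the coefficient of
  \<open>z^n\<close> in \<open>exp (\<Sum>i=1..N. x i * z^i / fact i)\<close>.\<close>

definition part_weight :: "nat \<Rightarrow> (nat \<Rightarrow> 'a::field_char_0) \<Rightarrow> (nat \<Rightarrow> nat) \<Rightarrow> 'a" where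
  "part_weight N x p = (\<Prod>i=1..N. (x i / fact i) ^ p i / fact (p i))"

lemma part_mults_le:
  assumes "p \<in> part_mults N n"
  shows "i * p i \<le> n"
proof (cases "i \<in> {1..N}")
  case True
  then have "i * p i \<le> (\<Sum>i=1..N. i * p i)"
    by (intro member_le_sum) auto
  then show ?thesis using assms by (simp add: part_mults_def)
next
  case False
  then show ?thesis using assms by (auto simp: part_mults_def)
qed

lemma finite_part_mults: "finite (part_mults N n)"
proof (rule finite_subset)
  show "part_mults N n \<subseteq> {p. \<forall>i. (i \<in> {1..N} \<longrightarrow> p i \<in> {0..n}) \<and> (i \<notin> {1..N} \<longrightarrow> p i = 0)}"
  proof safe
    fix p i assume p: "p \<in> part_mults N n"
    show "p i \<in> {0..n}" if "i \<in> {1..N}"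
    proof -
      have "p i \<le> i * p i" using that by (cases i) auto
      also have "\<dots> \<le> n" by (rule part_mults_le[OF p])
      finally show ?thesis by simp
    qed
    show "p i = 0" if "i \<notin> {1..N}" using that p by (simp add: part_mults_def)
  qed
qed (rule finite_set_of_finite_funs; simp)

text \<open>With \<open>k\<close> parts in total, \<open>\<Sum>i. (i - 1) * p i\<close> equals
  \<open>n - k\<close>, and a single part of size \<open>i\<close> already contributes
  \<open>i - 1\<close>. Hence the index range of \<open>partial_bell\<close> omits no part
  size.\<close>

lemma part_mults_eq_0:
  assumes "p \<in> part_mults N n" "(\<Sum>i=1..N. p i) = k" "i > n - k + 1"
  shows "p i = 0"
proof (rule ccontr)
  assume nz: "p i \<noteq> 0"
  with assms(1) have i: "i \<in> {1..N}" by (auto simp: part_mults_def)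
  have "n = (\<Sum>i=1..N. i * p i)" using assms(1) by (simp add: part_mults_def)
  also have "\<dots> = (\<Sum>i=1..N. (i - 1) * p i + p i)"
    by (intro sum.cong) (auto simp: algebra_simps)
  also have "\<dots> = (\<Sum>i=1..N. (i - 1) * p i) + k" using assms(2) by (simp add: sum.distrib)
  finally have *: "(\<Sum>i=1..N. (i - 1) * p i) + k = n" by simp
  have "i - 1 \<le> (i - 1) * p i" using nz by simp
  also have "\<dots> \<le> (\<Sum>i=1..N. (i - 1) * p i)"
    by (rule member_le_sum[where f="\<lambda>i. (i - 1) * p i"]) (use i in auto)
  finally show False using * assms(3) by linarith
qed

text \<open>Both sums run over the same partitions: \<open>partial_bell\<close> encodes them as
  functions that are \<open>undefined\<close> beyond \<open>n - k + 1\<close>,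
  \<open>part_mults\<close> as functions that vanish there, and the bijection only exchanges these
  default values. The bound \<open>n < N\<close> is strict because for \<open>k = 0\<close> the
  index range reaches \<open>n + 1\<close>.\<close>

lemma partial_bell_eq_part_weight:
  assumes "k \<le> n" "n < N"
  shows "partial_bell n k x =
    (\<Sum>p | p \<in> part_mults N n \<and> (\<Sum>i=1..N. p i) = k. fact n * part_weight N x p)"
  unfolding partial_bell_def
proof (rule sum.reindex_bij_witness[where
      i = "\<lambda>p. restrict p {1..n-k+1}" and
      j = "\<lambda>q i. if i \<in> {1..n-k+1} then q i else 0"], goal_cases)
  case (1 a)
  then show ?case by (auto simp: PiE_def extensional_def restrict_def)
next
  case (2 a)
  let ?m = "n - k + 1"
  have mN: "?m \<le> N" using assms by linarith
  have ext: "(\<Sum>i=1..N. g i * (if i \<in> {1..?m} then a i else 0)) = (\<Sum>i=1..?m. g i * a i)" for g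
    using mN by (intro sum.mono_neutral_cong_right) auto
  show ?case using 2 mN ext[of "\<lambda>_. 1"] ext[of "\<lambda>i. i"]
    by (auto simp: part_mults_def)
next
  case (3 b)
  then have "b i = 0" if "i \<notin> {1..n - k + 1}" for i
    using that part_mults_eq_0[of b N n k i] by (cases "i = 0") (auto simp: part_mults_def)
  then show ?case by (auto simp: fun_eq_iff)
next
  case (4 b)
  let ?m = "n - k + 1"
  have mN: "?m \<le> N" using assms by linarith
  have b0: "b i = 0" if "i \<notin> {1..?m}" for i
    using 4 that part_mults_eq_0[of b N n k i] by (cases "i = 0") (auto simp: part_mults_def)
  have ext: "(\<Sum>i=1..N. g i * b i) = (\<Sum>i=1..?m. g i * restrict b {1..?m} i)" for g
    by (intro sum.mono_neutral_cong_right) (use mN b0 in auto)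
  have "b i \<le> k" for i
  proof (cases "i \<in> {1..N}")
    case True
    then have "b i \<le> (\<Sum>i=1..N. b i)" by (intro member_le_sum) auto
    then show ?thesis using 4 by simp
  next
    case False
    then show ?thesis using 4 by (auto simp: part_mults_def)
  qed
  then show ?case using 4 ext[of "\<lambda>_. 1"] ext[of "\<lambda>i. i"]
    by (auto simp: part_mults_def)
next
  case (5 a)
  let ?m = "n - k + 1"
  have mN: "?m \<le> N" using assms by linarith
  have "part_weight N x (\<lambda>i. if i \<in> {1..?m} then a i else 0) =
        (\<Prod>i=1..?m. (x i / fact i) ^ a i / fact (a i))"
    unfolding part_weight_def
    by (intro prod.mono_neutral_cong_right) (use mN in auto)
  then show ?case by (simp add: prod_dividef)
qed

lemma bell_poly_eq_part_weight:
  assumes "n < N"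
  shows "bell_poly n x = fact n * (\<Sum>p\<in>part_mults N n. part_weight N x p)"
proof -
  have le: "(\<Sum>i=1..N. p i) \<le> n" if "p \<in> part_mults N n" for p
  proof -
    have "(\<Sum>i=1..N. p i) \<le> (\<Sum>i=1..N. i * p i)" by (intro sum_mono) auto
    then show ?thesis using that by (simp add: part_mults_def)
  qed
  have "bell_poly n x = (\<Sum>k=0..n. \<Sum>p | p \<in> part_mults N n \<and> (\<Sum>i=1..N. p i) = k.
          fact n * part_weight N x p)"
    unfolding bell_poly_def using assms
    by (intro sum.cong refl partial_bell_eq_part_weight) auto
  also have "\<dots> = (\<Sum>p\<in>part_mults N n. fact n * part_weight N x p)"
    by (rule sum.group) (use le finite_part_mults in auto)
  finally show ?thesis by (simp add: sum_distrib_left)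
qed

lemma part_weight_Suc:
  assumes "i \<in> {1..N}"
  shows "of_nat (Suc (q i)) * part_weight N x (q(i := Suc (q i))) = x i / fact i * part_weight N x q"
proof -
  have "part_weight N x (q(i := Suc (q i))) =
     (x i / fact i) ^ Suc (q i) / fact (Suc (q i)) * (\<Prod>j\<in>{1..N}-{i}. (x j / fact j) ^ q j / fact (q j))"
    unfolding part_weight_def using assms by (subst prod.remove[of _ i]) (auto intro!: prod.cong)
  moreover have "part_weight N x q =
     (x i / fact i) ^ (q i) / fact (q i) * (\<Prod>j\<in>{1..N}-{i}. (x j / fact j) ^ q j / fact (q j))"
    unfolding part_weight_def using assms by (subst prod.remove[of _ i]) auto
  ultimately show ?thesis by (simp add: fact_Suc del: of_nat_Suc)
qed

text \<open>Removing one part of size \<open>i\<close> maps the partitions of \<open>n\<close> that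
  have such a part bijectively onto the partitions of \<open>n - i\<close>. The factor
  \<open>p i\<close> cancels against \<open>fact (p i)\<close>, which leaves
  \<open>x i / fact i\<close>.\<close>

lemma sum_part_weight_shift:
  fixes x :: "nat \<Rightarrow> 'a::field_char_0"
  assumes i: "i \<in> {1..N}" and "i \<le> n"
  shows "(\<Sum>p\<in>part_mults N n. of_nat (p i) * part_weight N x p) =
         x i / fact i * (\<Sum>p\<in>part_mults N (n - i). part_weight N x p)"
proof -
  have shift: "(\<Sum>j=1..N. j * (p(i := v)) j) + i * p i = (\<Sum>j=1..N. j * p j) + i * v" for p v
  proof -
    have "(\<Sum>j\<in>{1..N} - {i}. j * (p(i := v)) j) = (\<Sum>j\<in>{1..N} - {i}. j * p j)"
      by (intro sum.cong) auto
    then show ?thesis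
      using sum.remove[OF _ i, of "\<lambda>j. j * (p(i := v)) j"] sum.remove[OF _ i, of "\<lambda>j. j * p j"]
      by simp
  qed
  have "(\<Sum>p\<in>part_mults N n. of_nat (p i) * part_weight N x p) =
        (\<Sum>p | p \<in> part_mults N n \<and> p i \<noteq> 0. of_nat (p i) * part_weight N x p)"
    by (intro sum.mono_neutral_right) (auto simp: finite_part_mults)
  also have "\<dots> = (\<Sum>q\<in>part_mults N (n - i). x i / fact i * part_weight N x q)"
  proof (rule sum.reindex_bij_witness[where i = "\<lambda>q. q(i := Suc (q i))" and j = "\<lambda>p. p(i := p i - 1)"], goal_cases)
    case (2 p)
    then show ?case using shift[of p "p i - 1"] i
      by (cases "p i") (auto simp: part_mults_def)
  next
    case (4 q)
    then show ?case using shift[of q "Suc (q i)"] i \<open>i \<le> n\<close>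
      by (auto simp: part_mults_def)
  next
    case (5 p)
    then show ?case using part_weight_Suc[OF i, of "p(i := p i - 1)" x] by simp
  qed auto
  finally show ?thesis by (simp add: sum_distrib_left)
qed

text \<open>The coefficient form of \<open>(exp f)' = f' * exp f\<close>: each partition of
  \<open>Suc n\<close> is counted with its size \<open>\<Sum>i. i * p i\<close>, the two sums are
  swapped, and one part of size \<open>i\<close> is removed.\<close>

lemma bell_poly_Suc:
  fixes x :: "nat \<Rightarrow> 'a::field_char_0"
  shows "bell_poly (Suc n) x = (\<Sum>j=0..n. of_nat (n choose j) * x (Suc j) * bell_poly (n - j) x)"
proof -
  \<comment> \<open>The least \<open>N\<close> for which \<open>bell_poly_eq_part_weight\<close>
    covers every index up to \<open>Suc n\<close>.\<close>
  define N where "N = n + 2"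
  define b where "b k = (\<Sum>p\<in>part_mults N k. part_weight N x p)" for k
  have bell: "bell_poly k x = fact k * b k" if "k \<le> Suc n" for k
    unfolding b_def by (rule bell_poly_eq_part_weight) (use that N_def in simp)
  have "of_nat (Suc n) * b (Suc n) =
      (\<Sum>p\<in>part_mults N (Suc n). \<Sum>i=1..N. of_nat i * (of_nat (p i) * part_weight N x p))"
    unfolding b_def sum_distrib_left
  proof (rule sum.cong[OF refl])
    fix p assume "p \<in> part_mults N (Suc n)"
    then have "of_nat (Suc n) = (of_nat (\<Sum>i=1..N. i * p i) :: 'a)" by (simp add: part_mults_def)
    then show "of_nat (Suc n) * part_weight N x p =
        (\<Sum>i=1..N. of_nat i * (of_nat (p i) * part_weight N x p))"
      by (simp add: sum_distrib_right mult.assoc del: of_nat_Suc)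
  qed
  also have "\<dots> = (\<Sum>i=1..N. of_nat i * (\<Sum>p\<in>part_mults N (Suc n). of_nat (p i) * part_weight N x p))"
    by (subst sum.swap) (simp add: sum_distrib_left)
  \<comment> \<open>The only index dropped is \<open>n + 2\<close>, and a partition of
    \<open>Suc n\<close> has no part that large.\<close>
  also have "\<dots> = (\<Sum>i=1..Suc n. of_nat i * (x i / fact i * b (Suc n - i)))"
  proof (rule sum.mono_neutral_cong_right)
    show "\<forall>i\<in>{1..N} - {1..Suc n}. of_nat i * (\<Sum>p\<in>part_mults N (Suc n). of_nat (p i) * part_weight N x p) = 0"
    proof
      fix i assume i: "i \<in> {1..N} - {1..Suc n}"
      have "p i = 0" if "p \<in> part_mults N (Suc n)" for p
        using part_mults_le[OF that, of i] i by (cases "p i") auto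
      then have "(\<Sum>p\<in>part_mults N (Suc n). of_nat (p i) * part_weight N x p) = 0"
        by (intro sum.neutral) simp
      then show "of_nat i * (\<Sum>p\<in>part_mults N (Suc n). of_nat (p i) * part_weight N x p) = 0"
        by simp
    qed
  qed (auto simp: N_def b_def sum_part_weight_shift)
  also have "\<dots> = (\<Sum>j=0..n. of_nat (Suc j) * (x (Suc j) / fact (Suc j) * b (n - j)))"
    using sum.shift_bounds_cl_Suc_ivl[of "\<lambda>i. of_nat i * (x i / fact i * b (Suc n - i))" 0 n] by simp
  also have "\<dots> = (\<Sum>j=0..n. x (Suc j) / fact j * b (n - j))"
    by (intro sum.cong) (auto simp: fact_Suc simp del: of_nat_Suc)
  finally have "bell_poly (Suc n) x = fact n * (\<Sum>j=0..n. x (Suc j) / fact j * b (n - j))"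
    by (simp add: bell fact_Suc mult.assoc mult.left_commute del: of_nat_Suc)
  also have "\<dots> = (\<Sum>j=0..n. of_nat (n choose j) * x (Suc j) * bell_poly (n - j) x)"
    unfolding sum_distrib_left
    by (intro sum.cong) (auto simp: bell binomial_fact)
  finally show ?thesis .
qed

lemma bell_poly_0: "bell_poly 0 x = 1"
proof -
  have "part_mults 1 0 = {\<lambda>_. 0}"
  proof (intro set_eqI iffI)
    fix p assume "p \<in> part_mults 1 0"
    then have "p i = 0" for i
      by (cases "i = 1") (auto simp: part_mults_def)
    then show "p \<in> {\<lambda>_. 0}" by auto
  qed (simp add: part_mults_def)
  then show ?thesis
    by (simp add: bell_poly_eq_part_weight[of 0 1] part_weight_def)
qed

section \<open>Higher derivatives of exponentials and of power series\<close>

text \<open>The first derivative is \<open>deriv f w * exp (f w)\<close>; the Leibniz rule for the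
  remaining ones reproduces the recurrence \<open>bell_poly_Suc\<close>.\<close>

lemma higher_deriv_exp_compose:
  fixes f :: "complex \<Rightarrow> complex"
  assumes f: "f holomorphic_on S" and S: "open S" and z: "z \<in> S"
  shows "(deriv ^^ n) (\<lambda>w. exp (f w)) z = exp (f z) * bell_poly n (\<lambda>j. (deriv ^^ j) f z)"
proof (induction n rule: less_induct)
  case (less n)
  show ?case
  proof (cases n)
    case 0
    then show ?thesis by (simp add: bell_poly_0)
  next
    case (Suc m)
    have hol: "deriv f holomorphic_on S" "(\<lambda>w. exp (f w)) holomorphic_on S"
      using f S by (auto intro!: holomorphic_intros holomorphic_deriv)
    have d: "deriv (\<lambda>w. exp (f w)) w = deriv f w * exp (f w)" if "w \<in> S" for w
    proof -
      have "(f has_field_derivative deriv f w) (at w)"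
        using f S that by (rule holomorphic_derivI)
      then have "((\<lambda>w. exp (f w)) has_field_derivative exp (f w) * deriv f w) (at w)"
        by (rule DERIV_chain[OF DERIV_exp, unfolded o_def])
      then show ?thesis by (simp add: DERIV_imp_deriv mult.commute)
    qed
    have "(deriv ^^ n) (\<lambda>w. exp (f w)) z = (deriv ^^ m) (deriv (\<lambda>w. exp (f w))) z"
      unfolding Suc funpow_Suc_right by simp
    also have "\<dots> = (deriv ^^ m) (\<lambda>w. deriv f w * exp (f w)) z"
      using hol S z d
      by (intro higher_deriv_transform_within_open[where S=S]) (auto intro!: holomorphic_intros holomorphic_deriv)
    also have "\<dots> = (\<Sum>i=0..m. of_nat (m choose i) * (deriv ^^ i) (deriv f) z *
                     (deriv ^^ (m - i)) (\<lambda>w. exp (f w)) z)"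
      by (rule higher_deriv_mult[OF hol S z])
    also have "\<dots> = (\<Sum>i=0..m. exp (f z) * (of_nat (m choose i) * (deriv ^^ Suc i) f z *
                     bell_poly (m - i) (\<lambda>j. (deriv ^^ j) f z)))"
      by (intro sum.cong refl) (simp add: less.IH Suc funpow_Suc_right del: funpow.simps)
    also have "\<dots> = exp (f z) * bell_poly n (\<lambda>j. (deriv ^^ j) f z)"
      by (simp add: Suc bell_poly_Suc sum_distrib_left del: funpow.simps)
    finally show ?thesis .
  qed
qed

text \<open>Translating the centre to \<open>0\<close> reduces this to the derivative formula for
  evaluated formal power series.\<close>

lemma higher_deriv_power_series:
  fixes a :: "nat \<Rightarrow> complex"
  assumes sums: "\<And>w. w \<in> ball z r \<Longrightarrow> (\<lambda>k. a k * (w - z) ^ k) sums f w" and r: "0 < r"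
  shows "(deriv ^^ n) f z = fact n * a n"
proof -
  have ev: "eventually (\<lambda>x. f (z + x) = eval_fps (Abs_fps a) x) (nhds 0)"
  proof (rule eventually_mono[OF eventually_nhds_in_open[of "ball 0 r"]])
    fix x :: complex assume "x \<in> ball 0 r"
    then show "f (z + x) = eval_fps (Abs_fps a) x"
      using sums[of "z + x"] by (simp add: eval_fps_def sums_iff dist_norm)
  qed (use r in auto)
  \<comment> \<open>Convergence at one nonzero point, here at distance \<open>r/2\<close> from the
    centre, makes the convergence radius positive.\<close>
  have "summable (\<lambda>k. a k * of_real (r/2) ^ k)"
    using sums[of "z + of_real (r/2)"] r by (simp add: sums_iff dist_norm)
  then have "conv_radius a \<ge> norm (of_real (r/2) :: complex)"
    by (rule conv_radius_geI)
  then have "fps_conv_radius (Abs_fps a) > 0"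
    using r unfolding fps_conv_radius_def by (auto elim: less_le_trans[rotated] simp: zero_ereal_def)
  then have "fps_nth (Abs_fps a) n = (deriv ^^ n) (eval_fps (Abs_fps a)) 0 / fact n"
    by (rule fps_nth_conv_deriv)
  also have "(deriv ^^ n) (eval_fps (Abs_fps a)) 0 = (deriv ^^ n) (\<lambda>x. f (z + x)) 0"
    by (rule higher_deriv_cong_ev) (use ev in \<open>auto elim: eventually_mono\<close>)
  also have "\<dots> = (deriv ^^ n) f z"
    using higher_deriv_shift_0[of n f z] by (simp add: o_def)
  finally show ?thesis by (simp add: field_simps)
qed

section \<open>The identity theorem along the imaginary axis\<close>

text \<open>The series defines a holomorphic function on the disc that agrees with \<open>f\<close>
  on \<open>U\<close>; as \<open>U\<close> accumulates at the centre, the two agree on the whole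
  disc. A countable \<open>U\<close> is allowed, which suits identities that hold only almost surely
  at each point.\<close>

lemma higher_deriv_eq_of_sums_on_islimpt:
  fixes a :: "nat \<Rightarrow> complex"
  assumes f: "f holomorphic_on ball z r" and r: "0 < r"
    and summable: "\<And>w. w \<in> ball z r \<Longrightarrow> summable (\<lambda>k. a k * (w - z) ^ k)"
    and U: "z islimpt U" "U \<subseteq> ball z r"
    and sums: "\<And>w. w \<in> U \<Longrightarrow> (\<lambda>k. a k * (w - z) ^ k) sums f w"
  shows "(deriv ^^ n) f z = fact n * a n"
proof (rule higher_deriv_power_series[OF _ r])
  define g where "g w = (\<Sum>k. a k * (w - z) ^ k)" for w
  have g: "(\<lambda>k. a k * (w - z) ^ k) sums g w" if "w \<in> ball z r" for w
    unfolding g_def using summable[OF that] by (rule summable_sums)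
  have hol: "g holomorphic_on ball z r"
    using g by (rule power_series_holomorphic)
  fix w assume w: "w \<in> ball z r"
  have "f w - g w = 0"
  proof (rule analytic_continuation[where S = "ball z r" and U = U and \<xi> = z and f = "\<lambda>w. f w - g w"])
    show "(\<lambda>w. f w - g w) holomorphic_on ball z r"
      using f hol by (rule holomorphic_on_diff)
    show "f w - g w = 0" if "w \<in> U" for w
      using sums[OF that] by (simp add: g_def sums_iff)
  qed (use U r w in auto)
  then show "(\<lambda>k. a k * (w - z) ^ k) sums f w" using g[OF w] by simp
qed

lemma dist_imaginary_axis: "dist (\<i> * complex_of_real y) \<i> = \<bar>y - 1\<bar>"
proof -
  have "\<i> * complex_of_real y - \<i> = \<i> * complex_of_real (y - 1)"
    by (simp add: algebra_simps)
  then show ?thesis by (simp only: dist_norm norm_mult norm_of_real) simp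
qed

lemma imaginary_unit_islimpt: "\<i> islimpt ((\<lambda>y. \<i> * complex_of_real y) ` (\<rat> \<inter> {0<..<1}))"
  unfolding islimpt_approachable
proof (intro allI impI)
  fix e :: real assume e: "0 < e"
  then obtain q where q: "q \<in> \<rat>" "max 0 (1 - e) < q" "q < 1"
    using Rats_dense_in_real[of "max 0 (1 - e)" 1] by auto
  with dist_imaginary_axis[of q] show "\<exists>x'\<in>(\<lambda>y. \<i> * complex_of_real y) ` (\<rat> \<inter> {0<..<1}). x' \<noteq> \<i> \<and> dist x' \<i> < e"
    by (intro bexI[of _ "\<i> * of_real q"]) auto
qed

text \<open>The bound on \<open>c\<close> gives convergence on the unit disc around
  \<open>\<i>\<close>, which lies in the upper half-plane. At \<open>w = \<i> * y\<close> one has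
  \<open>1 - y = \<i> * (w - \<i>)\<close>, so the coefficient of \<open>(w - \<i>)^k\<close> is
  \<open>c k * \<i>^k\<close>.\<close>

lemma higher_deriv_from_rational_ray:
  fixes c :: "nat \<Rightarrow> real"
  assumes f: "f holomorphic_on {u. 0 < Im u}"
    and c: "\<And>k. \<bar>c k\<bar> \<le> 1"
    and ray: "\<And>y. y \<in> \<rat> \<Longrightarrow> 0 < y \<Longrightarrow> y < 1 \<Longrightarrow>
      (\<lambda>k. c k * (1 - y) ^ k) sums g y \<and> f (\<i> * of_real y) = of_real (g y)"
  shows "(deriv ^^ n) f \<i> = fact n * (of_real (c n) * \<i> ^ n)"
proof (rule higher_deriv_eq_of_sums_on_islimpt[where r = 1 and
      U = "(\<lambda>y. \<i> * complex_of_real y) ` (\<rat> \<inter> {0<..<1})"])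
  have "0 < Im u" if "u \<in> ball \<i> 1" for u
    using that abs_Im_le_cmod[of "\<i> - u"] by (auto simp: dist_norm)
  then show "f holomorphic_on ball \<i> 1"
    by (intro holomorphic_on_subset[OF f]) auto
  show "summable (\<lambda>k. of_real (c k) * \<i> ^ k * (w - \<i>) ^ k)" if "w \<in> ball \<i> 1" for w
  proof (rule summable_comparison_test')
    show "summable (\<lambda>k. norm (w - \<i>) ^ k)"
      using that by (intro summable_geometric) (simp add: dist_norm norm_minus_commute)
    show "norm (of_real (c k) * \<i> ^ k * (w - \<i>) ^ k) \<le> norm (w - \<i>) ^ k" for k
      using mult_right_mono[OF c[of k], of "norm (w - \<i>) ^ k"]
      by (simp add: norm_mult norm_power)
  qed
  show "(\<lambda>y. \<i> * complex_of_real y) ` (\<rat> \<inter> {0<..<1}) \<subseteq> ball \<i> 1"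
    using dist_imaginary_axis by (auto simp: dist_commute)
  show "(\<lambda>k. of_real (c k) * \<i> ^ k * (w - \<i>) ^ k) sums f w"
    if "w \<in> (\<lambda>y. \<i> * complex_of_real y) ` (\<rat> \<inter> {0<..<1})" for w
  proof -
    from that obtain y where y: "w = \<i> * of_real y" "y \<in> \<rat>" "0 < y" "y < 1"
      by (auto simp: image_iff)
    have "\<i> * (w - \<i>) = of_real (1 - y)"
      by (simp add: y algebra_simps)
    then have "\<i> ^ k * (w - \<i>) ^ k = of_real ((1 - y) ^ k)" for k
      by (metis of_real_power power_mult_distrib)
    moreover have "(\<lambda>k. complex_of_real (c k * (1 - y) ^ k)) sums of_real (g y)"
      using ray[of y] y by (intro sums_of_real) auto
    ultimately show ?thesis using ray[of y] y by (simp add: mult.assoc)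
  qed
qed (use imaginary_unit_islimpt in auto)

section \<open>Jump times and the threshold event\<close>

lemma hazard_process_nonneg:
  assumes "hazard_process M F \<Lambda>" "x \<in> space M" "0 \<le> T"
  shows "0 \<le> \<Lambda> T x"
proof -
  have "\<Lambda> 0 x = 0" "mono_on {0..} (\<lambda>t. \<Lambda> t x)"
    using assms by (auto simp: hazard_process_def)
  then show ?thesis
    using mono_onD[of "{0..}" "\<lambda>t. \<Lambda> t x" 0 T] assms(3) by simp
qed

text \<open>If the threshold is reached at \<open>T\<close>, then \<open>T\<close> lies in the set
  whose infimum is taken. Otherwise right-continuity keeps \<open>\<Lambda>\<close> below the
  threshold slightly beyond \<open>T\<close>, which makes the inequality for the infimum
  strict.\<close>

lemma jump_time_gt_iff:
  assumes haz: "hazard_process M F \<Lambda>" and \<omega>: "\<omega> \<in> space M" and T: "0 < T"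
  shows "ereal T < jump_time \<Lambda> \<eta> n \<omega> \<longleftrightarrow> \<Lambda> T \<omega> < (\<Sum>i=1..n. \<eta> i \<omega>)"
proof
  assume gt: "ereal T < jump_time \<Lambda> \<eta> n \<omega>"
  show "\<Lambda> T \<omega> < (\<Sum>i=1..n. \<eta> i \<omega>)"
  proof (rule ccontr)
    assume "\<not> ?thesis"
    then have "jump_time \<Lambda> \<eta> n \<omega> \<le> ereal T"
      unfolding jump_time_def using T by (intro Inf_lower) auto
    with gt show False by simp
  qed
next
  let ?s = "\<Sum>i=1..n. \<eta> i \<omega>"
  assume less: "\<Lambda> T \<omega> < ?s"
  have mono: "mono_on {0..} (\<lambda>t. \<Lambda> t \<omega>)" and "continuous (at_right T) (\<lambda>s. \<Lambda> s \<omega>)"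
    using haz \<omega> T by (auto simp: hazard_process_def)
  then have "((\<lambda>s. \<Lambda> s \<omega>) \<longlongrightarrow> \<Lambda> T \<omega>) (at_right T)"
    by (simp add: continuous_within)
  then have "eventually (\<lambda>s. \<Lambda> s \<omega> < ?s) (at_right T)"
    using less by (rule order_tendstoD)
  then obtain b where b: "T < b" "\<And>s. T < s \<Longrightarrow> s < b \<Longrightarrow> \<Lambda> s \<omega> < ?s"
    unfolding eventually_at_right_field by auto
  \<comment> \<open>At the midpoint \<open>\<Lambda>\<close> is still below the threshold, so by
    monotonicity no earlier time reaches it and \<open>r\<close> is a lower bound beyond
    \<open>T\<close>.\<close>
  define r where "r = (T + b) / 2"
  have r: "T < r" "r < b" using b(1) by (auto simp: r_def)
  have "ereal r \<le> jump_time \<Lambda> \<eta> n \<omega>"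
    unfolding jump_time_def
  proof (rule Inf_greatest, safe)
    fix s assume s: "0 < s" "?s \<le> \<Lambda> s \<omega>"
    show "ereal r \<le> ereal s"
    proof (rule ccontr)
      assume "\<not> ?thesis"
      then have "\<Lambda> s \<omega> \<le> \<Lambda> r \<omega>"
        using s r T by (intro mono_onD[OF mono]) auto
      with b(2)[OF r] s(2) show False by simp
    qed
  qed
  then show "ereal T < jump_time \<Lambda> \<eta> n \<omega>"
    using r(1) by (meson ereal_less_eq(3) less_ereal.simps(1) less_le_trans)
qed

section \<open>The conditional probability of a late jump\<close>

text \<open>By independence the joint law of the outcome, seen through \<open>G\<close>, and of
  \<open>S\<close> is a product. Fubini freezes \<open>X x\<close>, and the Erlang tail beyond
  \<open>X x\<close> is a partial sum of Poisson weights.\<close>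

lemma (in prob_space) erlang_exceeds_independent:
  assumes indep: "indep_set (sets G) {S -` B \<inter> space M |B. B \<in> sets borel}"
    and S: "distributed M lborel S (erlang_density k 1)"
    and G: "subalgebra M G"
    and X: "X \<in> borel_measurable G" and X0: "\<And>x. x \<in> space M \<Longrightarrow> 0 \<le> X x"
    and A: "A \<in> sets G"
  shows "emeasure M (A \<inter> {x \<in> space M. X x < S x}) =
    (\<integral>\<^sup>+x. ennreal (indicator A x * (\<Sum>n\<le>k. X x ^ n * exp (- X x) / fact n)) \<partial>M)"
proof -
  have sp: "space G = space M" using G by (simp add: subalgebra_def)
  have Sm [measurable]: "S \<in> borel_measurable M"
    using distributed_measurable[OF S] by simp
  \<comment> \<open>The identity as a map into the coarser space \<open>G\<close>; its law is the
    probability restricted to \<open>sets G\<close>, so the first coordinate carries both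
    \<open>A\<close> and \<open>X\<close>.\<close>
  have id: "(\<lambda>x. x) \<in> measurable M G"
    using G by (auto simp: subalgebra_def measurable_def)
  note X [measurable] A [measurable]
  define B where "B = {p \<in> space (G \<Otimes>\<^sub>M borel). fst p \<in> A \<and> X (fst p) < snd p}"
  have B: "B \<in> sets (G \<Otimes>\<^sub>M borel)"
    unfolding B_def by measurable
  interpret D: prob_space "distr M borel S" by (rule prob_space_distr) simp
  have A_sub: "A \<subseteq> space M" using sets.sets_into_space[OF A] sp by simp
  have prod: "distr M (G \<Otimes>\<^sub>M borel) (\<lambda>x. (x, S x)) = distr M G (\<lambda>x. x) \<Otimes>\<^sub>M distr M borel S"
  proof (rule pair_measure_eqI[symmetric])
    fix C U assume "C \<in> sets (distr M G (\<lambda>x. x))" "U \<in> sets (distr M borel S)"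
    then have [measurable]: "C \<in> sets G" "U \<in> sets borel" by auto
    have C: "C \<inter> space M = C" using sets.sets_into_space[of C G] sp by auto
    have "prob (C \<inter> (S -` U \<inter> space M)) = prob C * prob (S -` U \<inter> space M)"
      by (rule indep_setD[OF indep]) auto
    moreover have "emeasure (distr M (G \<Otimes>\<^sub>M borel) (\<lambda>x. (x, S x))) (C \<times> U) = emeasure M (C \<inter> (S -` U \<inter> space M))"
      using id by (subst emeasure_distr) (auto intro!: arg_cong[where f="emeasure M"])
    ultimately show "emeasure (distr M G (\<lambda>x. x)) C * emeasure (distr M borel S) U =
        emeasure (distr M (G \<Otimes>\<^sub>M borel) (\<lambda>x. (x, S x))) (C \<times> U)"
      using id C by (simp add: emeasure_distr emeasure_eq_measure ennreal_mult')
  next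
    show "sigma_finite_measure (distr M G (\<lambda>x. x))"
      using id by (intro prob_space_imp_sigma_finite prob_space_distr)
  qed (use D.sigma_finite_measure_axioms in \<open>simp_all cong: sets_pair_measure_cong\<close>)
  have "emeasure M (A \<inter> {x \<in> space M. X x < S x}) =
        emeasure (distr M (G \<Otimes>\<^sub>M borel) (\<lambda>x. (x, S x))) B"
  proof (subst emeasure_distr)
    show "(\<lambda>x. (x, S x)) \<in> measurable M (G \<Otimes>\<^sub>M borel)"
      using id by measurable
    show "emeasure M (A \<inter> {x \<in> space M. X x < S x}) = emeasure M ((\<lambda>x. (x, S x)) -` B \<inter> space M)"
      using A_sub sp by (intro arg_cong[where f="emeasure M"]) (auto simp: B_def space_pair_measure)
  qed (rule B)
  also have "\<dots> = emeasure (distr M G (\<lambda>x. x) \<Otimes>\<^sub>M distr M borel S) B"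
    by (simp only: prod)
  also have "\<dots> = (\<integral>\<^sup>+x. emeasure (distr M borel S) (Pair x -` B) \<partial>distr M G (\<lambda>x. x))"
    by (rule D.emeasure_pair_measure_alt) (use B in \<open>simp cong: sets_pair_measure_cong\<close>)
  also have "\<dots> = (\<integral>\<^sup>+x. emeasure (distr M borel S) (Pair x -` B) \<partial>M)"
    by (rule nn_integral_distr[OF id])
      (use D.measurable_emeasure_Pair[of B G] B in \<open>simp cong: sets_pair_measure_cong measurable_cong_sets\<close>)
  also have "\<dots> = (\<integral>\<^sup>+x. ennreal (indicator A x * (\<Sum>n\<le>k. X x ^ n * exp (- X x) / fact n)) \<partial>M)"
  proof (rule nn_integral_cong)
    fix x assume x: "x \<in> space M"
    show "emeasure (distr M borel S) (Pair x -` B) =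
      ennreal (indicator A x * (\<Sum>n\<le>k. X x ^ n * exp (- X x) / fact n))"
    proof (cases "x \<in> A")
      case True
      have "Pair x -` B = {X x<..}"
        using True x sp by (auto simp: B_def space_pair_measure)
      then have "emeasure (distr M borel S) (Pair x -` B) = emeasure M (S -` {X x<..} \<inter> space M)"
        by (simp add: emeasure_distr)
      also have "\<dots> = ennreal (\<P>(y in M. X x < S y))"
        unfolding emeasure_eq_measure by (intro arg_cong[where f="\<lambda>A. ennreal (prob A)"]) auto
      also have "\<P>(y in M. X x < S y) = 1 - erlang_CDF k 1 (X x)"
        using S X0[OF x] by (intro erlang_distributed_gt) auto
      also have "\<dots> = (\<Sum>n\<le>k. X x ^ n * exp (- X x) / fact n)"
        using X0[OF x] by (simp add: erlang_CDF_def)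
      finally show ?thesis using True by simp
    next
      case False
      then have "Pair x -` B = {}" by (auto simp: B_def)
      then show ?thesis using False by simp
    qed
  qed
  finally show ?thesis .
qed

text \<open>These are Poisson probabilities with parameter \<open>x\<close>: one term of the
  exponential series is at most \<open>exp x\<close>.\<close>

lemma power_exp_fact_bounds:
  fixes x :: real
  assumes "0 \<le> x"
  shows "0 \<le> x ^ k * exp (- x) / fact k" "x ^ k * exp (- x) / fact k \<le> 1"
proof -
  have "x ^ k / fact k \<le> (\<Sum>n. x ^ n / fact n)"
  proof -
    have "(\<Sum>n\<in>{k}. x ^ n / fact n) \<le> (\<Sum>n. x ^ n / fact n)"
      using assms summable_exp_generic[of x]
      by (intro sum_le_suminf) (auto simp: divide_inverse mult.commute)
    then show ?thesis by simp
  qed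
  also have "\<dots> = exp x"
    by (simp add: exp_def divide_inverse mult.commute)
  finally have "x ^ k / fact k * exp (- x) \<le> exp x * exp (- x)"
    by (intro mult_right_mono) auto
  then show "x ^ k * exp (- x) / fact k \<le> 1" by (simp add: exp_minus)
qed (use assms in simp)

text \<open>Independence passes to smaller sigma-algebras: \<open>F T\<close> lies in
  \<open>sigma_infinity M F\<close>, and the partial sum is a measurable function of the threshold
  vector.\<close>

lemma (in prob_space) indep_set_thresholds:
  assumes filt: "filtration_usual M F" and thr: "exponential_thresholds M F m \<eta>"
    and "0 \<le> T" "n \<le> m"
  shows "indep_set (sets (F T)) {(\<lambda>x. \<Sum>i=1..n. \<eta> i x) -` B \<inter> space M |B. B \<in> sets borel}"
proof -
  let ?S = "\<lambda>x. \<Sum>i=1..n. \<eta> i x"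
  let ?V = "vimage_algebra (space M) (\<lambda>\<omega>. \<lambda>i\<in>{1..m}. \<eta> i \<omega>) (\<Pi>\<^sub>M i\<in>{1..m}. borel)"
  have sub: "subalgebra M (F s)" if "0 \<le> s" for s
    using filt that by (simp add: filtration_usual_def)
  have ind: "indep_set (sets (sigma_infinity M F)) (sets ?V)"
    using thr by (simp add: exponential_thresholds_def)
  have "(\<Union>t\<in>{0..}. sets (F t)) \<subseteq> Pow (space M)"
    using sub sets.sets_into_space by (fastforce simp: subalgebra_def)
  then have inf: "sets (F T) \<subseteq> sets (sigma_infinity M F)"
    unfolding sigma_infinity_def using \<open>0 \<le> T\<close> by auto
  have "(\<lambda>f. \<Sum>i=1..n. f i) \<circ> (\<lambda>\<omega>. \<lambda>i\<in>{1..m}. \<eta> i \<omega>) \<in> measurable ?V borel"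
  proof (rule measurable_comp)
    show "(\<lambda>\<omega>. \<lambda>i\<in>{1..m}. \<eta> i \<omega>) \<in> measurable ?V (\<Pi>\<^sub>M i\<in>{1..m}. borel)"
      by (rule measurable_vimage_algebra1) (auto simp: space_PiM)
    show "(\<lambda>f. \<Sum>i=1..n. f i :: real) \<in> borel_measurable (\<Pi>\<^sub>M i\<in>{1..m}. borel)"
      using \<open>n \<le> m\<close> by (intro borel_measurable_sum measurable_component_singleton) auto
  qed
  moreover have "(\<lambda>f. \<Sum>i=1..n. f i) \<circ> (\<lambda>\<omega>. \<lambda>i\<in>{1..m}. \<eta> i \<omega>) = ?S"
    using \<open>n \<le> m\<close> by (auto intro!: sum.cong)
  ultimately have S: "?S \<in> measurable ?V borel" by simp
  have "{?S -` A \<inter> space M |A. A \<in> sets borel} \<subseteq> sets ?V"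
    using measurable_sets[OF S] by auto
  then show ?thesis
    using ind inf unfolding indep_sets2_eq by blast
qed

text \<open>The Erlang computation takes place over \<open>F T\<close>, where
  \<open>\<Lambda> T\<close> is measurable. Restricting the test sets to the smaller
  \<open>F t\<close> then characterises the conditional expectation given
  \<open>F t\<close>.\<close>

lemma (in prob_space) cond_prob_jump_time:
  assumes filt: "filtration_usual M F" and haz: "hazard_process M F \<Lambda>"
    and thr: "exponential_thresholds M F m \<eta>"
    and tT: "0 \<le> t" "t < T" and n: "1 \<le> n" "n \<le> m"
  shows "AE \<omega> in M. cond_prob_given M (F t) {x \<in> space M. ereal T < jump_time \<Lambda> \<eta> n x} \<omega> =
    (\<Sum>k=0..n-1. real_cond_exp M (F t) (\<lambda>x. \<Lambda> T x ^ k * exp (- \<Lambda> T x) / fact k) \<omega>)"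
proof -
  let ?S = "\<lambda>x. \<Sum>i=1..n. \<eta> i x"
  let ?f = "\<lambda>k x. \<Lambda> T x ^ k * exp (- \<Lambda> T x) / fact k"
  have sub: "subalgebra M (F t)" "subalgebra M (F T)"
    using filt tT unfolding filtration_usual_def by simp_all
  have le: "sets (F t) \<subseteq> sets (F T)"
    using filt tT unfolding filtration_usual_def by (meson less_imp_le)
  interpret G: finite_measure_subalgebra M "F t"
    by unfold_locales (rule sub)
  have XT: "\<Lambda> T \<in> borel_measurable (F T)"
    using haz tT by (simp add: hazard_process_def)
  have XM [measurable]: "\<Lambda> T \<in> borel_measurable M"
    using measurable_from_subalg[OF sub(2) XT] .
  have X0: "0 \<le> \<Lambda> T x" if "x \<in> space M" for x
    by (rule hazard_process_nonneg[OF haz that]) (use tT in simp)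
  have fint: "integrable M (?f k)" for k
    by (rule integrable_const_bound[where B=1]) (use power_exp_fact_bounds X0 in \<open>auto intro!: AE_I2\<close>)
  define E where "E = {x \<in> space M. \<Lambda> T x < ?S x}"
  have E_eq: "{x \<in> space M. ereal T < jump_time \<Lambda> \<eta> n x} = E"
    unfolding E_def using jump_time_gt_iff[OF haz] tT by auto
  have ind: "indep_set (sets (F T)) {?S -` B \<inter> space M |B. B \<in> sets borel}"
    by (rule indep_set_thresholds[OF filt thr]) (use tT n in auto)
  \<comment> \<open>The index of \<open>erlang_density\<close> is one less than the number of
    exponential summands.\<close>
  have erl: "distributed M lborel ?S (erlang_density (n - 1) 1)"
  proof -
    have "indep_vars (\<lambda>_. borel) \<eta> {1..n}"
      by (rule indep_vars_subset[of _ _ "{1..m}"])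
        (use thr n in \<open>auto simp: exponential_thresholds_def\<close>)
    then show ?thesis
      using exponential_distributed_sum[of "{1..n}" 1 \<eta>] thr n
      by (auto simp: exponential_thresholds_def)
  qed
  have [measurable]: "?S \<in> borel_measurable M" using distributed_measurable[OF erl] by simp
  have E [measurable]: "E \<in> events" unfolding E_def by measurable
  show ?thesis
    unfolding E_eq cond_prob_given_def
  proof (rule G.real_cond_exp_charact)
    fix A assume A: "A \<in> sets (F t)"
    then have AT: "A \<in> sets (F T)" and AM [measurable]: "A \<in> events"
      using le sub by (auto simp: subalgebra_def)
    have "ennreal (prob (A \<inter> E)) =
       (\<integral>\<^sup>+x. ennreal (indicator A x * (\<Sum>k\<le>n-1. ?f k x)) \<partial>M)"
      using erlang_exceeds_independent[OF ind erl sub(2) XT X0 AT]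
      by (simp add: E_def emeasure_eq_measure)
    also have "\<dots> = ennreal (\<integral>x. indicator A x * (\<Sum>k\<le>n-1. ?f k x) \<partial>M)"
    proof (rule nn_integral_eq_integral)
      show "integrable M (\<lambda>x. indicator A x * (\<Sum>k\<le>n-1. ?f k x))"
        using integrable_mult_indicator[OF AM, of "\<lambda>x. \<Sum>k\<le>n-1. ?f k x"] fint by simp
      show "AE x in M. 0 \<le> indicator A x * (\<Sum>k\<le>n-1. ?f k x)"
        using X0 power_exp_fact_bounds(1) by (auto intro!: AE_I2 mult_nonneg_nonneg sum_nonneg)
    qed
    finally have "prob (A \<inter> E) = (\<integral>x. indicator A x * (\<Sum>k\<le>n-1. ?f k x) \<partial>M)"
      using X0 power_exp_fact_bounds(1)
      by (subst (asm) ennreal_inj) (auto intro!: integral_nonneg_AE AE_I2 mult_nonneg_nonneg sum_nonneg)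
    also have "\<dots> = (\<Sum>k=0..n-1. \<integral>x\<in>A. ?f k x \<partial>M)"
      using integrable_mult_indicator[OF AM fint]
      by (simp add: set_lebesgue_integral_def sum_distrib_left atMost_atLeast0)
    also have "\<dots> = (\<Sum>k=0..n-1. \<integral>x\<in>A. real_cond_exp M (F t) (?f k) x \<partial>M)"
      by (intro sum.cong refl G.real_cond_exp_intA fint A)
    also have "\<dots> = (\<integral>x\<in>A. (\<Sum>k=0..n-1. real_cond_exp M (F t) (?f k) x) \<partial>M)"
      unfolding set_lebesgue_integral_def scaleR_sum_right
      by (rule Bochner_Integration.integral_sum[symmetric])
        (rule integrable_mult_indicator[OF AM G.real_cond_exp_int(1)[OF fint]])
    finally show "(\<integral>x\<in>A. indicat_real E x \<partial>M) =
        (\<integral>x\<in>A. (\<Sum>k=0..n-1. real_cond_exp M (F t) (?f k) x) \<partial>M)"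
      by (simp add: set_lebesgue_integral_def indicator_inter_arith[symmetric])
  qed (use G.real_cond_exp_int(1)[OF fint] in \<open>auto intro!: integrable_real_indicator simp: emeasure_eq_measure\<close>)
qed

section \<open>A power series for the conditional Laplace transform\<close>

text \<open>The geometric series in \<open>q\<close> dominates, which allows sum and integral to be
  exchanged. This serves both the Poisson weights and their conditional expectations, the latter
  being bounded only almost everywhere.\<close>

lemma (in prob_space) set_integral_power_series:
  fixes a :: "nat \<Rightarrow> 'a \<Rightarrow> real"
  assumes a [measurable]: "\<And>k. a k \<in> borel_measurable M"
    and bound: "\<And>k. AE x in M. \<bar>a k x\<bar> \<le> 1"
    and q: "0 \<le> q" "q < 1" and A [measurable]: "A \<in> events"
  shows "AE x in M. summable (\<lambda>k. a k x * q ^ k)"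
    and "integrable M (\<lambda>x. \<Sum>k. a k x * q ^ k)"
    and "(\<integral>x\<in>A. (\<Sum>k. a k x * q ^ k) \<partial>M) = (\<Sum>k. q ^ k * (\<integral>x\<in>A. a k x \<partial>M))"
proof -
  have geo: "summable (\<lambda>k. q ^ k)" using q by (intro summable_geometric) simp
  have all: "AE x in M. \<forall>k. \<bar>a k x\<bar> \<le> 1"
    using bound by (simp add: AE_all_countable)
  have le: "\<bar>a k x * q ^ k\<bar> \<le> q ^ k" if "\<forall>k. \<bar>a k x\<bar> \<le> 1" for x k
    using mult_right_mono[OF that[rule_format, of k], of "q ^ k"] q by (simp add: abs_mult)
  have summ: "AE x in M. summable (\<lambda>k. \<bar>a k x * q ^ k\<bar>)"
    using all by eventually_elim (rule summable_comparison_test'[OF geo], use le in auto)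
  then show "AE x in M. summable (\<lambda>k. a k x * q ^ k)"
    by eventually_elim (rule summable_rabs_cancel)
  have int: "integrable M (\<lambda>x. a k x * q ^ k)" for k
    by (rule integrable_const_bound[where B="q ^ k"]) (use all le in auto)
  have nle: "(\<integral>x. \<bar>a k x * q ^ k\<bar> \<partial>M) \<le> q ^ k" for k
  proof -
    have "(\<integral>x. \<bar>a k x * q ^ k\<bar> \<partial>M) \<le> (\<integral>x. q ^ k \<partial>M)"
      using all le int by (intro integral_mono_AE) auto
    then show ?thesis by (simp add: prob_space)
  qed
  show "integrable M (\<lambda>x. \<Sum>k. a k x * q ^ k)"
  proof (rule integrable_suminf[OF int])
    show "summable (\<lambda>k. \<integral>x. norm (a k x * q ^ k) \<partial>M)"
      by (rule summable_comparison_test'[OF geo]) (use nle in simp)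
  qed (use summ in simp)
  have intA: "integrable M (\<lambda>x. indicator A x * (a k x * q ^ k))" for k
    using integrable_mult_indicator[OF A int] by simp
  have nleA: "(\<integral>x. \<bar>indicator A x * (a k x * q ^ k)\<bar> \<partial>M) \<le> q ^ k" for k
    by (rule order_trans[OF integral_mono nle])
      (use intA int in \<open>auto simp: indicator_def\<close>)
  have "(\<integral>x\<in>A. (\<Sum>k. a k x * q ^ k) \<partial>M) = (\<integral>x. (\<Sum>k. indicator A x * (a k x * q ^ k)) \<partial>M)"
    unfolding set_lebesgue_integral_def
    by (intro Bochner_Integration.integral_cong refl) (simp add: indicator_def)
  also have "\<dots> = (\<Sum>k. \<integral>x. indicator A x * (a k x * q ^ k) \<partial>M)"
  proof (rule integral_suminf[OF intA])
    show "AE x in M. summable (\<lambda>k. norm (indicator A x * (a k x * q ^ k)))"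
      using summ by eventually_elim (simp add: indicator_def)
    show "summable (\<lambda>k. \<integral>x. norm (indicator A x * (a k x * q ^ k)) \<partial>M)"
      by (rule summable_comparison_test'[OF geo]) (use nleA in simp)
  qed
  also have "\<dots> = (\<Sum>k. q ^ k * (\<integral>x\<in>A. a k x \<partial>M))"
  proof (rule suminf_cong)
    fix k
    have "(\<integral>x. indicator A x * (a k x * q ^ k) \<partial>M) = (\<integral>x. q ^ k * (indicator A x * a k x) \<partial>M)"
      by (simp add: mult_ac)
    then show "(\<integral>x. indicator A x * (a k x * q ^ k) \<partial>M) = q ^ k * (\<integral>x\<in>A. a k x \<partial>M)"
      by (simp add: set_lebesgue_integral_def)
  qed
  finally show "(\<integral>x\<in>A. (\<Sum>k. a k x * q ^ k) \<partial>M) = (\<Sum>k. q ^ k * (\<integral>x\<in>A. a k x \<partial>M))" .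
qed

text \<open>The expansion is centred at \<open>y = 1\<close>, the point \<open>u = \<i>\<close>: the
  factor \<open>exp (- x)\<close> is split off and \<open>exp ((1 - y) * x)\<close> is
  expanded.\<close>

lemma exp_power_series_shifted:
  fixes x y :: real
  shows "(\<lambda>k. x ^ k * exp (- x) / fact k * (1 - y) ^ k) sums exp (- y * x)"
proof -
  have "(\<lambda>k. exp (- x) * (((1 - y) * x) ^ k / fact k)) sums (exp (- x) * exp ((1 - y) * x))"
    using exp_converges[of "(1 - y) * x"] by (intro sums_mult) (simp add: divide_inverse mult.commute)
  moreover have "exp (- x) * exp ((1 - y) * x) = exp (- y * x)"
    by (simp add: exp_add[symmetric] algebra_simps)
  ultimately show ?thesis
    by (simp add: power_mult_distrib mult.commute mult.left_commute)
qed

lemma (in finite_measure_subalgebra) real_cond_exp_abs_le_1: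
  assumes f [measurable]: "f \<in> borel_measurable M" and "\<And>x. x \<in> space M \<Longrightarrow> 0 \<le> f x" "\<And>x. x \<in> space M \<Longrightarrow> f x \<le> 1"
  shows "AE x in M. \<bar>real_cond_exp M F f x\<bar> \<le> 1"
proof -
  have "integrable M f"
    by (rule integrable_const_bound[where B=1]) (use assms in \<open>auto intro!: AE_I2\<close>)
  moreover have "AE x in M. f x \<ge> 0" "AE x in M. f x \<le> 1"
    using assms by auto
  ultimately have "AE x in M. real_cond_exp M F f x \<ge> 0" "AE x in M. real_cond_exp M F f x \<le> 1"
    by (blast intro: real_cond_exp_ge_c real_cond_exp_le_c)+
  then show ?thesis by eventually_elim auto
qed

text \<open>Over each set of \<open>G\<close> the series is integrated term by term, each weight is
  replaced by its conditional expectation, and the terms are summed again.\<close>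

lemma (in prob_space) real_cond_exp_laplace_series:
  assumes G: "subalgebra M G" and X [measurable]: "X \<in> borel_measurable M"
    and X0: "\<And>x. x \<in> space M \<Longrightarrow> 0 \<le> X x" and y: "0 < y" "y < 1"
  shows "AE \<omega> in M. (\<lambda>k. real_cond_exp M G (\<lambda>x. X x ^ k * exp (- X x) / fact k) \<omega> * (1 - y) ^ k)
           sums real_cond_exp M G (\<lambda>x. exp (- y * X x)) \<omega>"
proof -
  interpret G: finite_measure_subalgebra M G by unfold_locales (rule G)
  let ?f = "\<lambda>k x. X x ^ k * exp (- X x) / fact k"
  let ?c = "\<lambda>k. real_cond_exp M G (?f k)"
  have fb: "AE x in M. \<bar>?f k x\<bar> \<le> 1" for k
    using power_exp_fact_bounds X0 by (auto intro!: AE_I2)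
  have cb: "AE x in M. \<bar>?c k x\<bar> \<le> 1" for k
    by (rule G.real_cond_exp_abs_le_1) (use power_exp_fact_bounds X0 in auto)
  have fint: "integrable M (?f k)" for k
    by (rule integrable_const_bound[where B=1]) (use fb in auto)
  have q: "0 \<le> 1 - y" "1 - y < 1" using y by auto
  have "AE \<omega> in M. real_cond_exp M G (\<lambda>x. exp (- y * X x)) \<omega> = (\<Sum>k. ?c k \<omega> * (1 - y) ^ k)"
  proof (rule G.real_cond_exp_charact)
    fix A assume A: "A \<in> sets G"
    then have AM: "A \<in> events" using G by (auto simp: subalgebra_def)
    have "(\<integral>x\<in>A. exp (- y * X x) \<partial>M) = (\<integral>x\<in>A. (\<Sum>k. ?f k x * (1 - y) ^ k) \<partial>M)"
      using exp_power_series_shifted by (simp add: sums_iff)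
    also have "\<dots> = (\<Sum>k. (1 - y) ^ k * (\<integral>x\<in>A. ?f k x \<partial>M))"
      by (rule set_integral_power_series(3)[OF _ fb q AM]) simp
    also have "\<dots> = (\<Sum>k. (1 - y) ^ k * (\<integral>x\<in>A. ?c k x \<partial>M))"
      using G.real_cond_exp_intA[OF fint A] by simp
    also have "\<dots> = (\<integral>x\<in>A. (\<Sum>k. ?c k x * (1 - y) ^ k) \<partial>M)"
      by (rule set_integral_power_series(3)[OF _ cb q AM, symmetric]) simp
    finally show "(\<integral>x\<in>A. exp (- y * X x) \<partial>M) = (\<integral>x\<in>A. (\<Sum>k. ?c k x * (1 - y) ^ k) \<partial>M)" .
  next
    show "integrable M (\<lambda>x. exp (- y * X x))"
      by (rule integrable_const_bound[where B=1]) (use X0 y in \<open>auto intro!: AE_I2\<close>)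
    show "integrable M (\<lambda>x. \<Sum>k. ?c k x * (1 - y) ^ k)"
      by (rule set_integral_power_series(2)[OF _ cb q sets.top]) simp
  qed simp
  moreover have "AE x in M. summable (\<lambda>k. ?c k x * (1 - y) ^ k)"
    by (rule set_integral_power_series(1)[OF _ cb q sets.top]) simp
  ultimately show ?thesis
    by eventually_elim (simp add: summable_sums)
qed

section \<open>Derivatives of the conditional characteristic function at \<open>\<i>\<close>\<close>

text \<open>On the imaginary axis the exponent is real, so \<open>\<phi>\<close> becomes a
  conditional Laplace transform.\<close>

lemma (in prob_space) cond_char_function_imaginary_axis:
  assumes G: "subalgebra M G" and phi: "cond_char_function M G X \<phi>" and y: "0 \<le> y"
  shows "AE \<omega> in M. \<phi> \<omega> (\<i> * of_real y) = of_real (real_cond_exp M G (\<lambda>x. exp (- y * X x)) \<omega>)"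
proof -
  interpret G: finite_measure_subalgebra M G by unfold_locales (rule G)
  have e: "exp (\<i> * (\<i> * of_real y) * of_real (X x)) = complex_of_real (exp (- y * X x))" for x
    by (simp add: mult.assoc[symmetric] exp_of_real[symmetric])
  have "AE \<omega> in M. \<phi> \<omega> (\<i> * of_real y) =
      complex_cond_exp M G (\<lambda>x. exp (\<i> * (\<i> * of_real y) * of_real (X x))) \<omega>"
    using phi y unfolding cond_char_function_def by (metis Im_i_times Re_complex_of_real)
  \<comment> \<open>The imaginary part is the conditional expectation of the zero function, which
    vanishes almost surely.\<close>
  moreover have "AE \<omega> in M. real_cond_exp M G (\<lambda>_. 0) \<omega> = 0"
    by (rule G.real_cond_exp_F_meas) auto
  ultimately show ?thesis
    unfolding e by eventually_elim (simp add: complex_cond_exp_def complex_eq_iff)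
qed

text \<open>Near \<open>z\<close> the values of \<open>f\<close> avoid the cut of the principal
  logarithm, so \<open>f = exp (ln f)\<close> on an open set and
  \<open>higher_deriv_exp_compose\<close> applies.\<close>

lemma higher_deriv_eq_bell_ln:
  fixes f :: "complex \<Rightarrow> complex"
  assumes f: "f holomorphic_on S" and S: "open S" and z: "z \<in> S" "f z \<notin> \<real>\<^sub>\<le>\<^sub>0"
  shows "(deriv ^^ n) f z = exp (ln (f z)) * bell_poly n (\<lambda>j. (deriv ^^ j) (\<lambda>u. ln (f u)) z)"
proof -
  define U where "U = S \<inter> f -` (- \<real>\<^sub>\<le>\<^sub>0)"
  have U: "open U"
    unfolding U_def using S f
    by (intro continuous_open_preimage holomorphic_on_imp_continuous_on) (auto simp: open_Compl)
  have hol: "f holomorphic_on U"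
    using f by (rule holomorphic_on_subset) (simp add: U_def)
  then have ln: "(\<lambda>u. ln (f u)) holomorphic_on U"
    by (intro holomorphic_intros) (auto simp: U_def)
  have zU: "z \<in> U" using z by (simp add: U_def)
  have exp_ln: "exp (ln (f w)) = f w" if "w \<in> U" for w
  proof -
    have "f w \<noteq> 0" using that by (auto simp: U_def)
    then show ?thesis by (rule exp_Ln)
  qed
  have "(deriv ^^ n) f z = (deriv ^^ n) (\<lambda>u. exp (ln (f u))) z"
    using hol ln U zU
    by (intro higher_deriv_transform_within_open[where S = U])
      (auto simp: exp_ln intro!: holomorphic_on_exp')
  also have "\<dots> = exp (ln (f z)) * bell_poly n (\<lambda>j. (deriv ^^ j) (\<lambda>u. ln (f u)) z)"
    by (rule higher_deriv_exp_compose[OF ln U zU])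
  finally show ?thesis .
qed

text \<open>The derivatives of \<open>\<phi>\<close> at \<open>\<i>\<close> are computed twice, from
  the series coefficients and from Bell polynomials of the logarithm, and the results are
  compared.\<close>

lemma (in prob_space) cond_char_function_bell:
  assumes G: "subalgebra M G" and X [measurable]: "X \<in> borel_measurable M"
    and X0: "\<And>x. x \<in> space M \<Longrightarrow> 0 \<le> X x" and phi: "cond_char_function M G X \<phi>"
  shows "AE \<omega> in M. \<forall>k. exp (ln (\<phi> \<omega> \<i>)) / (fact k * \<i> ^ k) *
      bell_poly k (\<lambda>j. (deriv ^^ j) (\<lambda>u. ln (\<phi> \<omega> u)) \<i>) =
      complex_of_real (real_cond_exp M G (\<lambda>x. X x ^ k * exp (- X x) / fact k) \<omega>)"
proof -
  interpret G: finite_measure_subalgebra M G by unfold_locales (rule G)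
  let ?c = "\<lambda>k. real_cond_exp M G (\<lambda>x. X x ^ k * exp (- X x) / fact k)"
  let ?g = "\<lambda>y. real_cond_exp M G (\<lambda>x. exp (- y * X x))"
  have hol: "AE \<omega> in M. \<phi> \<omega> holomorphic_on {u. 0 < Im u}"
    using phi by (simp add: cond_char_function_def)
  have bounded: "AE \<omega> in M. \<forall>k. \<bar>?c k \<omega>\<bar> \<le> 1"
    unfolding AE_all_countable
    by (intro allI G.real_cond_exp_abs_le_1) (use power_exp_fact_bounds X0 in auto)
  \<comment> \<open>Keeping \<open>y\<close> rational leaves countably many exceptional sets, whose
    union is null; outside it the argument is pathwise.\<close>
  have "AE \<omega> in M. \<forall>y\<in>\<rat> \<inter> {0<..<1}. (\<lambda>k. ?c k \<omega> * (1 - y) ^ k) sums ?g y \<omega>"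
    by (subst AE_ball_countable)
      (use real_cond_exp_laplace_series[OF G X X0] in \<open>auto intro: countable_Int1 countable_rat\<close>)
  moreover have "AE \<omega> in M. \<forall>y\<in>\<rat> \<inter> {0<..<1}. \<phi> \<omega> (\<i> * of_real y) = of_real (?g y \<omega>)"
    by (subst AE_ball_countable)
      (use cond_char_function_imaginary_axis[OF G phi] in \<open>auto intro: countable_Int1 countable_rat\<close>)
  moreover have "AE \<omega> in M. \<phi> \<omega> \<i> = of_real (?g 1 \<omega>)"
    using cond_char_function_imaginary_axis[OF G phi, of 1] by simp
  \<comment> \<open>Strict positivity puts \<open>\<phi> \<omega> \<i>\<close> on the positive real
    axis, away from the cut of \<open>ln\<close>.\<close>
  moreover have "AE \<omega> in M. ?g 1 \<omega> > 0"
  proof (rule G.real_cond_exp_gr_c)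
    show "integrable M (\<lambda>x. exp (- 1 * X x))"
      by (rule integrable_const_bound[where B=1]) (use X0 in auto)
  qed simp
  ultimately show ?thesis
    using hol bounded
  proof eventually_elim
    case (elim \<omega>)
    have deriv: "(deriv ^^ k) (\<phi> \<omega>) \<i> = fact k * (of_real (?c k \<omega>) * \<i> ^ k)" for k
      by (rule higher_deriv_from_rational_ray[where g = "\<lambda>y. ?g y \<omega>"]) (use elim in auto)
    have "\<phi> \<omega> \<i> \<notin> \<real>\<^sub>\<le>\<^sub>0" using elim by simp
    then have "(deriv ^^ k) (\<phi> \<omega>) \<i> = exp (ln (\<phi> \<omega> \<i>)) *
        bell_poly k (\<lambda>j. (deriv ^^ j) (\<lambda>u. ln (\<phi> \<omega> u)) \<i>)" for k
      using elim by (intro higher_deriv_eq_bell_ln) (auto simp: open_halfspace_Im_gt)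
    then show ?case
      using deriv by (simp add: field_simps)
  qed
qed

theorem theorem1p1:
  fixes M :: "'a measure"
    and F :: "real \<Rightarrow> 'a measure"
    and \<Lambda> :: "real \<Rightarrow> 'a \<Rightarrow> real"
    and \<eta> :: "nat \<Rightarrow> 'a \<Rightarrow> real"
    and \<phi> \<Psi> :: "'a \<Rightarrow> complex \<Rightarrow> complex"
    and m n :: nat
    and t T :: real
  assumes "prob_space M"
    and "filtration_usual M F"
    and "hazard_process M F \<Lambda>"
    and "exponential_thresholds M F m \<eta>"
    and "0 \<le> t" and "t < T"
    and "1 \<le> n" and "n \<le> m"
    and "cond_char_function M (F t) (\<Lambda> T) \<phi>"
    and "\<And>\<omega> u. \<Psi> \<omega> u = ln (\<phi> \<omega> u)"
    and "AE \<omega> in M. nn_cond_exp M (F t) (\<lambda>x. ennreal (\<Lambda> T x ^ n)) \<omega> < \<infinity>"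
  shows "let
      \<tau> = jump_time \<Lambda> \<eta> n;
      P = (\<lambda>\<omega>. complex_of_real (cond_prob_given M (F t) {x \<in> space M. ereal T < \<tau> x} \<omega>));
      S = (\<lambda>\<omega>. \<Sum>k=0..n-1. exp (\<Psi> \<omega> \<i>) / (fact k * \<i> ^ k) *
              bell_poly k (\<lambda>j. (deriv ^^ j) (\<Psi> \<omega>) \<i>))
    in (AE \<omega> in M. ereal t < \<tau> \<omega> \<longrightarrow>
          P \<omega> = indicator {x \<in> space M. ereal t < \<tau> x} \<omega> * S \<omega>) \<and>
       (AE \<omega> in M. P \<omega> = S \<omega>)"
proof -
  interpret prob_space M by fact
  let ?P = "cond_prob_given M (F t) {x \<in> space M. ereal T < jump_time \<Lambda> \<eta> n x}"
  let ?S = "\<lambda>\<omega>. \<Sum>k=0..n-1. exp (\<Psi> \<omega> \<i>) / (fact k * \<i> ^ k) *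
    bell_poly k (\<lambda>j. (deriv ^^ j) (\<Psi> \<omega>) \<i>)"
  have sub: "subalgebra M (F t)" "subalgebra M (F T)"
    using assms unfolding filtration_usual_def by simp_all
  have "\<Lambda> T \<in> borel_measurable (F T)"
    using assms by (simp add: hazard_process_def)
  then have X: "\<Lambda> T \<in> borel_measurable M"
    by (rule measurable_from_subalg[OF sub(2)])
  have X0: "0 \<le> \<Lambda> T x" if "x \<in> space M" for x
    by (rule hazard_process_nonneg[OF assms(3) that]) (use assms in simp)
  have \<Psi>: "\<Psi> \<omega> = (\<lambda>u. ln (\<phi> \<omega> u))" for \<omega>
    using assms(10) by auto
  have "AE \<omega> in M. \<forall>k. exp (\<Psi> \<omega> \<i>) / (fact k * \<i> ^ k) *
      bell_poly k (\<lambda>j. (deriv ^^ j) (\<Psi> \<omega>) \<i>) =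
      complex_of_real (real_cond_exp M (F t) (\<lambda>x. \<Lambda> T x ^ k * exp (- \<Lambda> T x) / fact k) \<omega>)"
    unfolding \<Psi> using sub(1) X X0 assms(9) by (rule cond_char_function_bell)
  then have eq: "AE \<omega> in M. complex_of_real (?P \<omega>) = ?S \<omega>"
    using cond_prob_jump_time[OF assms(2-8)] by eventually_elim simp
  \<comment> \<open>Where \<open>t\<close> precedes the jump time the indicator is \<open>1\<close>,
    so the claim reduces to \<open>eq\<close>; \<open>AE_space\<close> supplies the membership in
    \<open>space M\<close>.\<close>
  moreover have "AE \<omega> in M. ereal t < jump_time \<Lambda> \<eta> n \<omega> \<longrightarrow> complex_of_real (?P \<omega>) =
      indicator {x \<in> space M. ereal t < jump_time \<Lambda> \<eta> n x} \<omega> * ?S \<omega>"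
    using eq AE_space by eventually_elim simp
  ultimately show ?thesis by (simp add: Let_def)
qed

end
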